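(* Let $G$ be a simple graph with $\bar{\gamma}_p(G)=0$ such that $G$ has a vertex of degree one or a cut-vertex. Then $G=P_n$ (the path on $n$ vertices) for some $n\ge 1$.
   Context: For $v\in V$, $N[v]$ is the closed neighborhood; for $S\subseteq V$, $N[S]=\bigcup_{v\in S}N[v]$. Define $\mathcal{P}^0(S)=N[S]$, $\mathcal{P}^{i+1}(S)=\mathcal{P}^i(S)\cup\{w : \{w\}=N[v]\setminus\mathcal{P}^i(S)\text{ for some } v\in\mathcal{P}^i(S)\}$, with eventual value $\mathcal{P}^\infty(S)$. $S$ is a power dominating set (PDS) if $\mathcal{P}^\infty(S)=V$, and a failed power dominating set (FPDS) otherwise. $\bar{\gamma}_p(G)$ is the maximum cardinality of an FPDS of $G$. *)

theory Defs
  imports "Graph_Theory.Graph_Theory"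
begin

text \<open>
  Finite simple graphs are the models of the locale \<^locale>\<open>pair_graph\<close>: finite, loopless and
  without parallel arcs, every edge being represented by both of its orientations.
  Consequently the degree of a vertex is its out-degree, and the connected components are
  the strongly connected ones.
\<close>

definition closed_nbhd :: "'a pair_pre_digraph \<Rightarrow> 'a \<Rightarrow> 'a set" where
  "closed_nbhd G v = insert v {w. (v, w) \<in> parcs G}"

primrec observed :: "'a pair_pre_digraph \<Rightarrow> 'a set \<Rightarrow> nat \<Rightarrow> 'a set" where
  "observed G S 0 = (\<Union>v\<in>S. closed_nbhd G v)"
| "observed G S (Suc i) = observed G S i \<union>
     {w. \<exists>v\<in>observed G S i. {w} = closed_nbhd G v - observed G S i}"

text \<open>
  The sequence is increasing, so on a finite graph its eventual value is its union; see
  \<open>observed_eventually\<close> below.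
\<close>
definition observed_limit :: "'a pair_pre_digraph \<Rightarrow> 'a set \<Rightarrow> 'a set" where
  "observed_limit G S = (\<Union>i. observed G S i)"

definition power_dominating :: "'a pair_pre_digraph \<Rightarrow> 'a set \<Rightarrow> bool" where
  "power_dominating G S \<longleftrightarrow> S \<subseteq> pverts G \<and> observed_limit G S = pverts G"

definition failed_power_dominating :: "'a pair_pre_digraph \<Rightarrow> 'a set \<Rightarrow> bool" where
  "failed_power_dominating G S \<longleftrightarrow> S \<subseteq> pverts G \<and> \<not> power_dominating G S"

text \<open>
  This is meaningful exactly for nonempty graphs: there the empty set is a failed power
  dominating set, whereas the null graph has none.
\<close>
definition failed_power_domination_number :: "'a pair_pre_digraph \<Rightarrow> nat" where
  "failed_power_domination_number G = Max (card ` {S. failed_power_dominating G S})"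

definition cut_vertex :: "'a pair_pre_digraph \<Rightarrow> 'a \<Rightarrow> bool" where
  "cut_vertex G v \<longleftrightarrow> v \<in> pverts G \<and>
     card (pre_digraph.sccs_verts (with_proj G)) <
     card (pre_digraph.sccs_verts (pre_digraph.del_vert (with_proj G) v))"

definition path_graph :: "nat \<Rightarrow> nat pair_pre_digraph" where
  "path_graph n = \<lparr> pverts = {..<n},
     parcs = {(i, j). i < n \<and> j < n \<and> (j = Suc i \<or> i = Suc j)} \<rparr>"

lemma pair_graph_path_graph: "pair_graph (path_graph n)"
proof unfold_locales
  have "parcs (path_graph n) \<subseteq> {..<n} \<times> {..<n}"
    by (auto simp: path_graph_def)
  then show "finite (parcs (path_graph n))"
    by (rule finite_subset) simp
qed (auto simp: path_graph_def symmetric_def sym_def)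

lemma (in pair_wf_digraph) observed_subset:
  assumes "S \<subseteq> pverts G"
  shows "observed G S i \<subseteq> pverts G"
proof (induction i)
  case 0
  show ?case
    using assms by (auto simp: closed_nbhd_def dest: in_arcsD2)
next
  case (Suc i)
  have "w \<in> pverts G" if "v \<in> observed G S i" "{w} = closed_nbhd G v - observed G S i" for v w
  proof -
    have "w \<in> closed_nbhd G v"
      using that(2) by blast
    moreover have "v \<in> pverts G"
      using that(1) Suc by blast
    ultimately show ?thesis
      by (auto simp: closed_nbhd_def dest: in_arcsD2)
  qed
  then show ?case
    using Suc unfolding observed.simps by blast
qed

lemma observed_mono: "i \<le> j \<Longrightarrow> observed G S i \<subseteq> observed G S j"
  by (rule lift_Suc_mono_le) (simp_all add: le_supI1)

lemma (in pair_graph) observed_eventually: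
  assumes "S \<subseteq> pverts G"
  shows "\<exists>k. \<forall>i\<ge>k. observed G S i = observed_limit G S"
proof -
  have fin: "finite (observed_limit G S)"
  proof (rule finite_subset[OF _ pair_finite_verts])
    show "observed_limit G S \<subseteq> pverts G"
      unfolding observed_limit_def using observed_subset[OF assms] by blast
  qed
  have "\<forall>w\<in>observed_limit G S. \<exists>i. w \<in> observed G S i"
    by (auto simp: observed_limit_def)
  then obtain f where f: "\<And>w. w \<in> observed_limit G S \<Longrightarrow> w \<in> observed G S (f w)"
    by metis
  obtain k where k: "\<And>w. w \<in> observed_limit G S \<Longrightarrow> f w \<le> k"
    using finite_imageI[OF fin, of f] by (auto simp: finite_nat_set_iff_bounded_le)
  have limit: "observed_limit G S \<subseteq> observed G S k"
  proof
    fix w assume w: "w \<in> observed_limit G S"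
    show "w \<in> observed G S k"
      using observed_mono[OF k[OF w]] f[OF w] by (rule subsetD)
  qed
  have "observed G S i = observed_limit G S" if "i \<ge> k" for i
    using observed_mono[OF that, of G S] limit by (auto simp: observed_limit_def)
  then show ?thesis by blast
qed

lemma (in pair_graph) failed_power_domination_number_attained:
  assumes "pverts G \<noteq> {}"
  shows "\<exists>S. failed_power_dominating G S \<and> card S = failed_power_domination_number G"
    and "failed_power_dominating G S \<Longrightarrow> card S \<le> failed_power_domination_number G"
proof -
  let ?F = "{S. failed_power_dominating G S}"
  have "?F \<subseteq> Pow (pverts G)"
    by (auto simp: failed_power_dominating_def)
  then have "finite ?F"
    by (rule finite_subset) (simp add: pair_finite_verts)
  then have fin: "finite (card ` ?F)"
    by (rule finite_imageI)
  have "observed G {} i = {}" for i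
    by (induction i) auto
  then have "{} \<in> ?F"
    using assms by (auto simp: failed_power_dominating_def power_dominating_def observed_limit_def)
  then have "Max (card ` ?F) \<in> card ` ?F"
    using fin by (intro Max_in) auto
  then show "\<exists>S. failed_power_dominating G S \<and> card S = failed_power_domination_number G"
    by (auto simp: failed_power_domination_number_def)
  show "failed_power_dominating G S \<Longrightarrow> card S \<le> failed_power_domination_number G"
    using fin by (auto simp: failed_power_domination_number_def intro!: Max_ge)
qed

end

theory Submission
  imports Defs
begin

text \<open>
  Every single vertex is power dominating. Starting from a leaf, the observed set can
  therefore only grow by one vertex at a time, each new vertex being the only unobserved
  neighbour of the previous one, and so the graph is a path.

  A cut vertex \<open>v\<close> yields a leaf. Let \<open>B\<close> be a component of \<open>G - v\<close>. Observation started inside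
  \<open>B\<close> can leave \<open>B \<union> {v}\<close> only if \<open>v\<close> has a single neighbour outside \<open>B \<union> {v}\<close>. Observation
  started at \<open>v\<close> then runs along a chain outside \<open>B\<close>, and the end of this chain is a leaf.
\<close>

section \<open>Upper bounds for observation, and isomorphisms built from vertex maps\<close>

text \<open>Consider a first vertex \<open>w\<close> observed outside \<open>X\<close>. It is the
  only unobserved vertex in some \<open>closed_nbhd G v\<close> with \<open>v\<close> already in
  \<open>X\<close>. As everything observed so far lies in \<open>X\<close>, \<open>w\<close> is also
  the only vertex there outside \<open>X\<close>, which \<open>stuck\<close> excludes.\<close>

lemma observed_limit_subset:
  assumes "\<And>s. s \<in> S \<Longrightarrow> closed_nbhd G s \<subseteq> X"
    and stuck: "\<And>v w. v \<in> X \<Longrightarrow> closed_nbhd G v - X \<noteq> {w}"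
  shows "observed_limit G S \<subseteq> X"
proof -
  have "observed G S i \<subseteq> X" for i
  proof (induction i)
    case 0
    show ?case
      using assms(1) by auto
  next
    case (Suc i)
    have "w \<in> X" if "v \<in> observed G S i" "{w} = closed_nbhd G v - observed G S i" for v w
    proof (rule ccontr)
      assume "w \<notin> X"
      then have "closed_nbhd G v - X = {w}"
        using that(2) Suc by blast
      then show False
        using stuck that(1) Suc by blast
    qed
    then show ?case
      using Suc unfolding observed.simps by blast
  qed
  then show ?thesis
    by (auto simp: observed_limit_def)
qed

text \<open>An arc is the pair of its ends, so the vertex map \<open>f\<close> alone determines the
  arc map and hence the whole isomorphism record.\<close>

lemma digraph_iso_with_projI:
  assumes "pair_wf_digraph G"
    and "inj_on f (pverts G)"
    and "f ` pverts G = pverts H"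
    and "map_prod f f ` parcs G = parcs H"
  shows "digraph_iso (with_proj G) (with_proj H)"
proof -
  interpret pair_wf_digraph G by fact
  define h where "h = \<lparr>iso_verts = f, iso_arcs = map_prod f f, iso_head = snd, iso_tail = fst\<rparr>"
  have "parcs G \<subseteq> pverts G \<times> pverts G"
    by (auto dest: wellformed')
  then have "inj_on (map_prod f f) (parcs G)"
    using map_prod_inj_on[OF assms(2) assms(2)] by (rule inj_on_subset[rotated])
  then have "pre_digraph.digraph_isomorphism (with_proj G) h"
    using assms(2) wf_digraph_axioms
    by (auto simp: pre_digraph.digraph_isomorphism_def h_def)
  moreover have "with_proj H = app_iso h (with_proj G)"
    using assms(3,4) by (intro pre_digraph.equality) (auto simp: h_def)
  ultimately show ?thesis
    by (auto simp: digraph_iso_def)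
qed

section \<open>Neighbourhoods and single-vertex domination\<close>

context pair_graph
begin

lemma closed_nbhd_commute: "w \<in> closed_nbhd G v \<longleftrightarrow> v \<in> closed_nbhd G w"
  using pair_sym_arcs by (auto simp: closed_nbhd_def symmetric_def dest: symD)

lemma closed_nbhd_subset: "v \<in> pverts G \<Longrightarrow> closed_nbhd G v \<subseteq> pverts G"
  by (auto simp: closed_nbhd_def dest: wellformed')

lemma arc_iff_closed_nbhd: "(v, w) \<in> parcs G \<longleftrightarrow> w \<in> closed_nbhd G v - {v}"
  by (auto simp: closed_nbhd_def dest: pair_no_loops)

lemma out_degree_eq_card_closed_nbhd: "out_degree (with_proj G) v = card (closed_nbhd G v - {v})"
proof -
  have "out_arcs (with_proj G) v = Pair v ` (closed_nbhd G v - {v})"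
    using arc_iff_closed_nbhd by (auto simp: out_arcs_def)
  then show ?thesis
    by (simp add: out_degree_def card_image inj_on_def)
qed

text \<open>A failed singleton would have cardinality 1, above the maximum 0.\<close>

lemma singleton_power_dominating:
  assumes "failed_power_domination_number G = 0" and "v \<in> pverts G"
  shows "observed_limit G {v} = pverts G"
  using failed_power_domination_number_attained(2)[of "{v}"] assms
  by (auto simp: failed_power_dominating_def power_dominating_def)

section \<open>Forcing chains and the leaf case\<close>

text \<open>Take a longest chain of forcings starting at \<open>v\<close>. Together with
  \<open>B\<close> it is a set that observation from \<open>v\<close> cannot leave: \<open>B\<close>
  and the inner chain vertices have no neighbours outside, and the last vertex forces nothing by
  maximality. Domination by \<open>v\<close> then makes the chain exhaust the complement of
  \<open>B\<close>. The set \<open>B\<close> is empty when \<open>v\<close> is a leaf, and a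
  component of \<open>G - v\<close> when \<open>v\<close> is a cut vertex.\<close>

lemma spanning_chain:
  assumes dom: "observed_limit G {v} = pverts G"
    and v: "v \<in> pverts G"
    and B: "B \<subseteq> pverts G" "v \<notin> B" "\<And>b. b \<in> B \<Longrightarrow> closed_nbhd G b \<subseteq> insert v B"
    and single: "closed_nbhd G v - insert v B = {u}"
  obtains n x where "n \<ge> 1" "x 0 = v" "inj_on x {..n}" "x ` {..n} = pverts G - B"
    "\<And>i. i < n \<Longrightarrow> closed_nbhd G (x i) - (B \<union> x ` {..i}) = {x (Suc i)}"
proof -
  \<comment> \<open>Each vertex forces the next one when all of \<open>B\<close> counts as observed.
    Here \<open>n\<close> counts forcings, so the chain has \<open>n + 1\<close> vertices.\<close>
  define chain where "chain n x \<longleftrightarrow> x 0 = v \<and>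
    (\<forall>i<n. closed_nbhd G (x i) - (B \<union> x ` {..i}) = {x (Suc i)})" for n and x :: "nat \<Rightarrow> 'a"
  have inj: "inj_on x {..n}" and avoids: "x ` {..n} \<subseteq> pverts G - B" if c: "chain n x" for n x
  proof -
    have new: "x (Suc i) \<in> closed_nbhd G (x i)" "x (Suc i) \<notin> B" "x (Suc i) \<notin> x ` {..i}"
      if "i < n" for i
      using c that by (auto simp: chain_def)
    show "inj_on x {..n}"
    proof (rule linorder_inj_onI')
      fix i j assume "i \<in> {..n}" "j \<in> {..n}" "i < j"
      then have "x j \<notin> x ` {..j - 1}" "x i \<in> x ` {..j - 1}"
        using new(3)[of "j - 1"] by auto
      then show "x i \<noteq> x j"
        by metis
    qed
    have "x i \<in> pverts G - B" if "i \<le> n" for i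
      using that
    proof (induction i)
      case 0
      then show ?case
        using c v B(2) by (simp add: chain_def)
    next
      case (Suc i)
      then show ?case
        using new[of i] closed_nbhd_subset[of "x i"] by auto
    qed
    then show "x ` {..n} \<subseteq> pverts G - B"
      by auto
  qed
  \<comment> \<open>Chains are injective, so their length is bounded and a longest one
    exists.\<close>
  have bound: "n \<le> card (pverts G)" if ex: "\<exists>x. chain n x" for n
  proof -
    obtain x where c: "chain n x"
      using ex by blast
    then have "card {..n} \<le> card (pverts G)"
      using inj[OF c] avoids[OF c] by (intro card_inj_on_le[where f = x]) auto
    then show ?thesis
      by simp
  qed
  have "chain 1 (\<lambda>i. if i = 0 then v else u)"
    using single by (simp add: chain_def)
  then have one: "\<exists>x. chain 1 x"
    by blast
  obtain n where "\<exists>x. chain n x" and max: "\<And>m. \<exists>x. chain m x \<Longrightarrow> m \<le> n"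
    using GreatestI_nat[where P = "\<lambda>n. \<exists>x. chain n x", OF one bound]
      Greatest_le_nat[where P = "\<lambda>n. \<exists>x. chain n x", OF _ bound] by blast
  then obtain x where c: "chain n x"
    by blast
  have n: "n \<ge> 1"
    using max[OF one] .
  let ?X = "B \<union> x ` {..n}"
  have x0: "x 0 = v"
    using c by (simp add: chain_def)
  then have v_in: "v \<in> x ` {..n}"
    by force
  have step: "closed_nbhd G (x i) - (B \<union> x ` {..i}) = {x (Suc i)}" if "i < n" for i
    using c that by (simp add: chain_def)
  have inner: "closed_nbhd G (x i) \<subseteq> ?X" if "i < n" for i
  proof
    fix w assume "w \<in> closed_nbhd G (x i)"
    then have "w \<in> B \<union> x ` {..i} \<or> w = x (Suc i)"
      using step[OF that] by blast
    then show "w \<in> ?X"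
      using that by auto
  qed
  \<comment> \<open>A single neighbour outside \<open>?X\<close> would prolong the longest
    chain.\<close>
  have last: "closed_nbhd G (x n) - ?X \<noteq> {y}" for y
  proof
    assume y: "closed_nbhd G (x n) - ?X = {y}"
    let ?x = "x(Suc n := y)"
    have "closed_nbhd G (?x i) - (B \<union> ?x ` {..i}) = {?x (Suc i)}" if "i < Suc n" for i
    proof -
      have "?x ` {..i} = x ` {..i}"
        using that by (auto intro!: image_cong)
      then show ?thesis
        using that step[of i] y by (cases "i = n") auto
    qed
    then have "chain (Suc n) ?x"
      using x0 by (simp add: chain_def)
    then show False
      using max[of "Suc n"] by auto
  qed
  have "observed_limit G {v} \<subseteq> ?X"
  proof (rule observed_limit_subset)
    \<comment> \<open>Since \<open>n \<ge> 1\<close>, \<open>v\<close> is an inner vertex of the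
      chain, so the initially observed set already lies in \<open>?X\<close>.\<close>
    show "closed_nbhd G s \<subseteq> ?X" if "s \<in> {v}" for s
      using that inner[of 0] n x0 by simp
    show "closed_nbhd G w - ?X \<noteq> {y}" if w: "w \<in> ?X" for w y
    proof -
      consider "w \<in> B" | i where "w = x i" "i < n" | "w = x n"
        using w by (auto simp: le_less)
      then show ?thesis
      proof cases
        case 1
        then have "closed_nbhd G w \<subseteq> ?X"
          using B(3)[of w] v_in by blast
        then show ?thesis
          by blast
      next
        case 2
        then show ?thesis
          using inner[of i] by blast
      next
        case 3
        then show ?thesis
          using last by simp
      qed
    qed
  qed
  then have "x ` {..n} = pverts G - B"
    using dom avoids[OF c] by blast
  then show ?thesis
    using that n x0 inj[OF c] step by blast
qed

text \<open>By injectivity and disjointness from \<open>B\<close>, \<open>x j\<close> lies outside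
  the set removed in the forcing equation, which leaves only the successor of \<open>x i\<close>.
  Thus a chain is an induced path.\<close>

lemma chain_adjacent:
  assumes "i < n" "i < j" "j \<le> n" "inj_on x {..n}" "x ` {..n} \<inter> B = {}"
    and "closed_nbhd G (x i) - (B \<union> x ` {..i}) = {x (Suc i)}"
  shows "x j \<in> closed_nbhd G (x i) \<longleftrightarrow> j = Suc i"
proof -
  have "x j \<notin> B \<union> x ` {..i}"
    using assms(1-5) by (force dest: inj_onD)
  then have "x j \<in> closed_nbhd G (x i) \<longleftrightarrow> x j = x (Suc i)"
    using assms(6) by blast
  then show ?thesis
    using assms(1-4) by (auto simp: inj_on_eq_iff)
qed

lemma leaf_imp_path:
  assumes dom: "observed_limit G {v} = pverts G" and v: "v \<in> pverts G"
    and leaf: "closed_nbhd G v - {v} = {u}"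
  shows "\<exists>n\<ge>1. digraph_iso (with_proj G) (with_proj (path_graph n))"
proof -
  obtain n x where inj: "inj_on x {..n}" and "x ` {..n} = pverts G - {}"
    and step: "\<And>i. i < n \<Longrightarrow> closed_nbhd G (x i) - ({} \<union> x ` {..i}) = {x (Suc i)}"
    by (rule spanning_chain[OF dom v, of "{}" u]) (use leaf in auto)
  then have verts: "x ` {..n} = pverts G"
    by simp
  have adj: "x j \<in> closed_nbhd G (x i) \<longleftrightarrow> j = Suc i" if "i < j" "j \<le> n" for i j
    using chain_adjacent[where B = "{}"] inj step that by auto
  have arcs: "(x i, x j) \<in> parcs G \<longleftrightarrow> j = Suc i \<or> i = Suc j" if "i \<le> n" "j \<le> n" for i j
  proof (cases i j rule: linorder_cases)
    case less
    then have "x i \<noteq> x j"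
      using that inj by (auto simp: inj_on_eq_iff)
    then show ?thesis
      using less that adj by (auto simp: arc_iff_closed_nbhd)
  next
    case equal
    then show ?thesis
      by (simp add: arc_iff_closed_nbhd)
  next
    case greater
    then have "x i \<noteq> x j"
      using that inj by (auto simp: inj_on_eq_iff)
    then show ?thesis
      using greater that adj[of j i] closed_nbhd_commute[of "x j" "x i"]
      by (auto simp: arc_iff_closed_nbhd)
  qed
  \<comment> \<open>The isomorphism sends each vertex to its position in the chain; positions run
    from 0 to \<open>n\<close>, whence \<open>path_graph (Suc n)\<close>.\<close>
  let ?f = "the_inv_into {..n} x"
  have f: "?f (x i) = i" if "i \<le> n" for i
    using inj that by (simp add: the_inv_into_f_f)
  have "digraph_iso (with_proj G) (with_proj (path_graph (Suc n)))"
  proof (rule digraph_iso_with_projI)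
    show "pair_wf_digraph G"
      by unfold_locales
    show "inj_on ?f (pverts G)"
      using inj_on_the_inv_into[OF inj] verts by simp
    have "?f ` pverts G = {..n}"
      using f by (force simp flip: verts)
    then show "?f ` pverts G = pverts (path_graph (Suc n))"
      by (auto simp: path_graph_def)
    have "(i, j) \<in> map_prod ?f ?f ` parcs G \<longleftrightarrow> (i, j) \<in> parcs (path_graph (Suc n))" for i j
    proof
      assume "(i, j) \<in> map_prod ?f ?f ` parcs G"
      then obtain a b where ab: "(a, b) \<in> parcs G" "i = ?f a" "j = ?f b"
        by auto
      then obtain k l where "a = x k" "b = x l" "k \<le> n" "l \<le> n"
        using wellformed'[OF ab(1)] by (auto simp flip: verts)
      then show "(i, j) \<in> parcs (path_graph (Suc n))"
        using ab arcs f by (auto simp: path_graph_def)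
    next
      assume "(i, j) \<in> parcs (path_graph (Suc n))"
      then have "i \<le> n" "j \<le> n" "(x i, x j) \<in> parcs G"
        using arcs by (auto simp: path_graph_def)
      then show "(i, j) \<in> map_prod ?f ?f ` parcs G"
        using f by (intro rev_image_eqI[of "(x i, x j)"]) auto
    qed
    then show "map_prod ?f ?f ` parcs G = parcs (path_graph (Suc n))"
      by auto
  qed
  then show ?thesis
    by auto
qed

section \<open>From a cut vertex to a leaf\<close>

text \<open>\<open>B\<close> is one of at least two components of \<open>G - v\<close>. Another
  component \<open>D\<close> witnesses that \<open>insert v B\<close> is not the whole vertex
  set.\<close>

lemma cut_vertex_separation:
  assumes "cut_vertex G v"
  obtains B where "B \<noteq> {}" "B \<subseteq> pverts G" "v \<notin> B" "insert v B \<noteq> pverts G"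
    "\<And>b. b \<in> B \<Longrightarrow> closed_nbhd G b \<subseteq> insert v B"
proof -
  let ?H = "pre_digraph.del_vert (with_proj G) v"
  interpret H: fin_digraph ?H
    by (rule fin_digraph_del_vert)
  have v: "v \<in> pverts G" and less: "card sccs_verts < card H.sccs_verts"
    using assms by (auto simp: cut_vertex_def)
  \<comment> \<open>The component of \<open>v\<close> itself makes the count positive before
    deletion, so at least two components remain after it.\<close>
  have "card sccs_verts > 0"
    using scc_of_in_sccs_verts[OF v] finite_sccs_verts by (auto simp: card_gt_0_iff)
  then have "\<not> card H.sccs_verts \<le> Suc 0"
    using less by simp
  then obtain B D where BD: "B \<in> H.sccs_verts" "D \<in> H.sccs_verts" "B \<noteq> D"
    using card_le_Suc0_iff_eq[OF H.finite_sccs_verts] by blast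
  then have disj: "B \<inter> D = {}" and ne: "B \<noteq> {}" "D \<noteq> {}"
    using H.sccs_verts_disjoint by (auto simp: H.in_sccs_verts_conv_reachable)
  have sub: "B \<subseteq> pverts G - {v}" "D \<subseteq> pverts G - {v}"
    using BD H.sccs_verts_subsets by (auto simp: verts_del_vert)
  have "closed_nbhd G b \<subseteq> insert v B" if b: "b \<in> B" for b
  proof
    fix w assume w: "w \<in> closed_nbhd G b"
    show "w \<in> insert v B"
    proof (cases "w = v \<or> w = b")
      case True
      then show ?thesis
        using b by auto
    next
      case False
      then have "(b, w) \<in> parcs G" "(w, b) \<in> parcs G"
        using w closed_nbhd_commute by (auto simp: arc_iff_closed_nbhd)
      moreover have "b \<noteq> v"
        using b sub by blast
      \<comment> \<open>Both orientations of the edge survive the deletion of \<open>v\<close>, so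
        \<open>b\<close> and \<open>w\<close> are mutually reachable and share a strong
        component.\<close>
      ultimately have arcs: "(b, w) \<in> arcs_ends ?H" "(w, b) \<in> arcs_ends ?H"
        using False by (auto simp: arcs_ends_def del_vert_simps arc_to_ends_def
            intro: rev_image_eqI)
      then have "b \<rightarrow>\<^sup>*\<^bsub>?H\<^esub> w" "w \<rightarrow>\<^sup>*\<^bsub>?H\<^esub> b"
        by (auto intro: H.reachable_adjI)
      then show ?thesis
        using BD(1) b by (auto simp: H.in_sccs_verts_conv_reachable)
    qed
  qed
  moreover have "insert v B \<noteq> pverts G"
    using sub disj ne by blast
  ultimately show ?thesis
    using that ne sub by blast
qed

lemma cut_vertex_imp_leaf:
  assumes dom: "\<And>v. v \<in> pverts G \<Longrightarrow> observed_limit G {v} = pverts G"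
    and cut: "cut_vertex G v"
  shows "\<exists>w\<in>pverts G. \<exists>u. closed_nbhd G w - {w} = {u}"
proof -
  obtain B where B: "B \<noteq> {}" "B \<subseteq> pverts G" "v \<notin> B" "insert v B \<noteq> pverts G"
    and closed: "\<And>b. b \<in> B \<Longrightarrow> closed_nbhd G b \<subseteq> insert v B"
    using cut_vertex_separation[OF cut] by blast
  have v: "v \<in> pverts G"
    using cut by (simp add: cut_vertex_def)
  obtain b where b: "b \<in> B"
    using B(1) by blast
  \<comment> \<open>Otherwise observation from \<open>b\<close> is confined to
    \<open>insert v B\<close>: only \<open>v\<close> can have neighbours outside this set, and it
    never has exactly one.\<close>
  obtain u where single: "closed_nbhd G v - insert v B = {u}"
  proof (rule ccontr)
    assume "\<not> thesis"
    then have "\<And>u. closed_nbhd G v - insert v B \<noteq> {u}"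
      using that by blast
    then have "observed_limit G {b} \<subseteq> insert v B"
      using closed b by (intro observed_limit_subset) auto
    then show False
      using dom[of b] b B v by blast
  qed
  obtain n x where n: "n \<ge> 1" and x0: "x 0 = v" and inj: "inj_on x {..n}"
    and verts: "x ` {..n} = pverts G - B"
    and step: "\<And>i. i < n \<Longrightarrow> closed_nbhd G (x i) - (B \<union> x ` {..i}) = {x (Suc i)}"
    using spanning_chain[OF dom[OF v] v B(2,3) closed single] by blast
  have xn: "x n \<in> pverts G - B"
    using verts by blast
  have "x n \<noteq> v"
    using inj n x0 by (auto simp: inj_on_def)
  have adj: "x i \<in> closed_nbhd G (x n) \<longleftrightarrow> n = Suc i" if "i < n" for i
    using chain_adjacent[of i n n x B] that inj verts step closed_nbhd_commute by blast
  \<comment> \<open>A neighbour in \<open>B\<close> is impossible, since it would see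
    \<open>x n\<close>, which is neither in \<open>B\<close> nor equal to \<open>v\<close>. So
    \<open>w\<close> is an earlier chain vertex, and only the predecessor of \<open>x n\<close> is
    adjacent to it.\<close>
  have "w = x (n - 1)" if w: "w \<in> closed_nbhd G (x n) - {x n}" for w
  proof -
    have "w \<notin> B"
      using closed[of w] w closed_nbhd_commute[of w "x n"] xn \<open>x n \<noteq> v\<close> by blast
    then obtain i where i: "w = x i" "i \<le> n"
      using closed_nbhd_subset[of "x n"] w xn verts by blast
    then show ?thesis
      using w adj[of i] by (cases "i = n") auto
  qed
  then have "closed_nbhd G (x n) - {x n} \<subseteq> {x (n - 1)}"
    by (intro subsetI) simp
  moreover have "x (n - 1) \<in> closed_nbhd G (x n) - {x n}"
    using adj[of "n - 1"] n inj by (auto simp: inj_on_eq_iff)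
  ultimately have "closed_nbhd G (x n) - {x n} = {x (n - 1)}"
    by (metis subset_singletonD empty_iff)
  then show ?thesis
    using xn by blast
qed

end

theorem theorem5:
  fixes G :: "'a pair_pre_digraph"
  assumes "pair_graph G"
    and "failed_power_domination_number G = 0"
    and "(\<exists>v\<in>pverts G. out_degree (with_proj G) v = 1) \<or> (\<exists>v. cut_vertex G v)"
  shows "\<exists>n\<ge>1. digraph_iso (with_proj G) (with_proj (path_graph n))"
proof -
  interpret pair_graph G by fact
  have dom: "observed_limit G {v} = pverts G" if "v \<in> pverts G" for v
    using singleton_power_dominating[OF assms(2) that] .
  \<comment> \<open>Both alternatives of the hypothesis reduce to the existence of a leaf.\<close>
  have "\<exists>v\<in>pverts G. \<exists>u. closed_nbhd G v - {v} = {u}"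
    using assms(3) cut_vertex_imp_leaf[OF dom]
    by (auto simp: out_degree_eq_card_closed_nbhd card_1_singleton_iff)
  then show ?thesis
    using leaf_imp_path dom by blast
qed

end
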